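(* Let $\alpha,\beta\in\mathbb{R}$ and let $n\ge 2$ be an integer with $T_1(\alpha,\beta,n)\ne 0$. Then $$\begin{aligned} F_{n+1}^{(\alpha,\beta)}(x)={}&\left(\frac{2T_2(\alpha,\beta,n)}{T_1(\alpha,\beta,n)}x+\frac{2(n-1)T_5(\alpha,\beta,n)}{(n+1)T_1(\alpha,\beta,n)}\right)F_n^{(\alpha,\beta)}(x)\\ &-\frac{(n-2)T_3(\alpha,\beta,n)}{(n+1)T_1(\alpha,\beta,n)}(x-1)^2F_{n-1}^{(\alpha,\beta)}(x)\\ &-\frac{2T_4(\alpha,\beta,n)}{n(n+1)T_1(\alpha,\beta,n)}x(x-1)\bigl(F_n^{(\alpha,\beta)}(x)\bigr)', \end{aligned}$$ where the prime denotes the derivative with respect to $x$, and where for $n=2$ the term containing $F_{n-1}^{(\alpha,\beta)}(x)$ is read as $0$ because of the factor $n-2$.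
   Context: For $n\ge 0$ let $$N_{A_n}(x)=\frac{1}{n+1}\sum_{k=0}^{n}\binom{n+1}{k}\binom{n+1}{k+1}x^k,\qquad N_{B_n}(x)=\sum_{k=0}^n\binom{n}{k}^2x^k,$$ and for $n\ge 2$ let $$F_n^{(\alpha,\beta)}(x)=\alpha N_{B_n}(x)+\beta\, n x\, N_{A_{n-2}}(x).$$ Further let $$\begin{aligned} T_1(\alpha,\beta,n)&=(4n-2)\alpha+n\beta,\\ T_2(\alpha,\beta,n)&=(4n-1)\alpha+n\beta,\\ T_3(\alpha,\beta,n)&=4n\alpha+(n+1)\beta,\\ T_4(\alpha,\beta,n)&=6n\alpha+(n+1)\beta,\\ T_5(\alpha,\beta,n)&=(4n+1)\alpha+(n+1)\beta. \end{aligned}$$ *)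

theory Defs
  imports Complex_Main "HOL-Computational_Algebra.Polynomial"
begin

definition N_A :: "nat \<Rightarrow> real poly" where
  "N_A n = smult (1 / (real n + 1))
     (\<Sum>k\<le>n. monom (real ((n + 1) choose k) * real ((n + 1) choose (k + 1))) k)"

definition N_B :: "nat \<Rightarrow> real poly" where
  "N_B n = (\<Sum>k\<le>n. monom ((real (n choose k))\<^sup>2) k)"

(* Meaningful only for n \<ge> 2: for n < 2 the natural subtraction n - 2 truncates to 0. *)
definition F :: "real \<Rightarrow> real \<Rightarrow> nat \<Rightarrow> real poly" where
  "F \<alpha> \<beta> n = smult \<alpha> (N_B n) + smult (\<beta> * real n) ([:0, 1:] * N_A (n - 2))"

definition T1 :: "real \<Rightarrow> real \<Rightarrow> nat \<Rightarrow> real" where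
  "T1 \<alpha> \<beta> n = (4 * real n - 2) * \<alpha> + real n * \<beta>"

definition T2 :: "real \<Rightarrow> real \<Rightarrow> nat \<Rightarrow> real" where
  "T2 \<alpha> \<beta> n = (4 * real n - 1) * \<alpha> + real n * \<beta>"

definition T3 :: "real \<Rightarrow> real \<Rightarrow> nat \<Rightarrow> real" where
  "T3 \<alpha> \<beta> n = 4 * real n * \<alpha> + (real n + 1) * \<beta>"

definition T4 :: "real \<Rightarrow> real \<Rightarrow> nat \<Rightarrow> real" where
  "T4 \<alpha> \<beta> n = 6 * real n * \<alpha> + (real n + 1) * \<beta>"

definition T5 :: "real \<Rightarrow> real \<Rightarrow> nat \<Rightarrow> real" where
  "T5 \<alpha> \<beta> n = (4 * real n + 1) * \<alpha> + (real n + 1) * \<beta>"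

end

theory Submission
  imports Defs
begin

text \<open>
  Compare the coefficients of \<open>x^k\<close>. Every binomial coefficient that occurs is
  \<open>binom(m, k - j)\<close> with \<open>m \<le> n + 1\<close> and \<open>j \<le> n + 1 - m\<close>, hence a polynomial multiple of
  \<open>binom(n + 1, k)\<close>, also at the boundary, where the polynomial factors vanish. The recurrence
  thus becomes \<open>binom(n + 1, k)^2\<close> times an identity of rational functions in \<open>n\<close> and \<open>k\<close>.
\<close>

section \<open>Absorption identities for shifted binomial coefficients\<close>

text \<open>The coefficient of x^k in x^j (1 + x)^m. The guard is needed because for k < j the
  truncated difference k - j would give binom(m, 0) = 1 instead of 0.\<close>

definition shifted_choose :: "nat \<Rightarrow> nat \<Rightarrow> nat \<Rightarrow> real" where
  "shifted_choose m k j = (if k < j then 0 else real (m choose (k - j)))"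

lemma shifted_choose_0 [simp]: "shifted_choose m k 0 = real (m choose k)"
  by (simp add: shifted_choose_def)

text \<open>Absorption (m+1) binom(m, i-1) = i binom(m+1, i) with i = k - j. No bound on k is
  needed: for k = j the factor i is 0, and for k < j both entries are 0.\<close>

lemma shifted_choose_absorb_shift:
  "(real m + 1) * shifted_choose m k (Suc j) = (real k - real j) * shifted_choose (Suc m) k j"
proof (cases "j < k")
  case True
  then have "k - j = Suc (k - Suc j)"
    by simp
  then have "Suc m * (m choose (k - Suc j)) = (k - j) * (Suc m choose (k - j))"
    by (metis Suc_times_binomial)
  then have "real (Suc m) * real (m choose (k - Suc j)) = real (k - j) * real (Suc m choose (k - j))"
    by (metis of_nat_mult)
  with True show ?thesis
    by (simp add: shifted_choose_def of_nat_diff add.commute)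
qed (auto simp: shifted_choose_def)

text \<open>The companion absorption (m+1) binom(m, i) = (m+1-i) binom(m+1, i). Outside 0 \<le> i
  \<le> m+1 both binomials are 0; inside, the natural subtraction is exact.\<close>

lemma shifted_choose_absorb:
  "(real m + 1) * shifted_choose m k j
    = (real m + 1 + real j - real k) * shifted_choose (Suc m) k j"
proof (cases "k < j \<or> Suc m < k - j")
  case False
  then have "Suc m * (m choose (k - j)) = (Suc m - (k - j)) * (Suc m choose (k - j))"
    using binomial_absorb_comp[of "Suc m" "k - j"] by simp
  then have "real (Suc m) * real (m choose (k - j))
      = real (Suc m - (k - j)) * real (Suc m choose (k - j))"
    by (metis of_nat_mult)
  moreover have "real (Suc m - (k - j)) = real m + 1 + real j - real k"
    using False by auto
  ultimately show ?thesis
    using False by (simp add: shifted_choose_def add.commute del: binomial_Suc_Suc)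
qed (auto simp: shifted_choose_def binomial_eq_0 simp del: binomial_Suc_Suc)

text \<open>Absorption solved for the lower row: a proposed value \<open>v\<close> is confirmed by a
  division-free identity.\<close>

lemma shifted_choose_eqI:
  assumes "(real m + 1 + real j - real k) * shifted_choose (Suc m) k j = (real m + 1) * v"
  shows "shifted_choose m k j = v"
proof -
  have "real m + 1 \<noteq> 0"
    by linarith
  moreover have "(real m + 1) * shifted_choose m k j = (real m + 1) * v"
    using assms by (simp only: shifted_choose_absorb)
  ultimately show ?thesis
    by (metis mult_left_cancel)
qed

lemma shifted_choose_shift_eqI:
  assumes "(real k - real j) * shifted_choose (Suc m) k j = (real m + 1) * v"
  shows "shifted_choose m k (Suc j) = v"
proof -
  have "real m + 1 \<noteq> 0"
    by linarith
  moreover have "(real m + 1) * shifted_choose m k (Suc j) = (real m + 1) * v"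
    using assms by (simp only: shifted_choose_absorb_shift)
  ultimately show ?thesis
    by (metis mult_left_cancel)
qed

section \<open>Coefficients of the Narayana polynomials and of F\<close>

lemma coeff_N_A:
  "coeff (N_A n) k = real ((n + 1) choose k) * real ((n + 1) choose (k + 1)) / (real n + 1)"
  by (auto simp: N_A_def coeff_sum coeff_monom sum.delta binomial_eq_0)

lemma coeff_N_B: "coeff (N_B n) k = (real (n choose k))\<^sup>2"
  by (auto simp: N_B_def coeff_sum coeff_monom sum.delta binomial_eq_0)

text \<open>Writing the index as p + 2 avoids the truncated n - 2. The factor x in F moves the
  Narayana coefficient to position k - 1, and \<open>shifted_choose\<close> supplies the 0 at k =
  0.\<close>

lemma coeff_F:
  "coeff (F \<alpha> \<beta> (Suc (Suc p))) k
    = \<alpha> * (real (Suc (Suc p) choose k))\<^sup>2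
      + \<beta> * (real p + 2) / (real p + 1)
        * (real (Suc p choose k) * shifted_choose (Suc p) k 1)"
  by (cases k)
     (simp_all add: F_def coeff_N_A coeff_N_B shifted_choose_def del: binomial_Suc_Suc)

text \<open>
  Multiplying by \<open>m\<close> makes this hold at \<open>m = 0\<close> as well, although \<open>F \<alpha> \<beta> 1\<close> is a junk value.
\<close>
lemma coeff_monom_mult_F:
  "real m * coeff (monom 1 j * F \<alpha> \<beta> (Suc m)) k
    = \<alpha> * real m * (shifted_choose (Suc m) k j)\<^sup>2
      + \<beta> * (real m + 1) * (shifted_choose m k j * shifted_choose m k (Suc j))"
proof (cases m)
  case 0
  then show ?thesis
    by (auto simp: shifted_choose_def binomial_eq_0)
next
  case (Suc p)
  show ?thesis
  proof (cases "k < j")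
    case True
    then show ?thesis
      by (simp add: coeff_monom_mult shifted_choose_def)
  next
    case False
    then have "shifted_choose m k (Suc j) = shifted_choose m (k - j) 1"
      by (auto simp: shifted_choose_def)
    with False show ?thesis
      by (simp add: Suc coeff_monom_mult coeff_F shifted_choose_def distrib_left
            del: binomial_Suc_Suc)
         (simp add: field_simps)
  qed
qed

section \<open>Coefficients of the operators in the recurrence\<close>

lemma coeff_X_mult_pderiv:
  fixes p :: "'a::{comm_semiring_1,semiring_no_zero_divisors} poly"
  shows "coeff (monom 1 1 * pderiv p) k = of_nat k * coeff p k"
  by (cases k) (simp_all only: coeff_monom_mult coeff_pderiv, simp_all)

text \<open>The Euler operator x d/dx multiplies the k-th coefficient by k; split x(x-1)p' as x(xp')
  - xp'. At k = 0 the factor k - 1 meets a zero coefficient.\<close>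

lemma coeff_X_mult_X_minus_1_mult_pderiv:
  fixes p :: "real poly"
  shows "coeff ([:0, 1:] * [:-1, 1:] * pderiv p) k
    = (real k - 1) * coeff (monom 1 1 * p) k - real k * coeff p k"
proof -
  have "[:0, 1:] * [:-1, 1:] * pderiv p
      = monom 1 1 * (monom 1 1 * pderiv p) - monom 1 1 * pderiv p"
    by (simp add: monom_altdef algebra_simps)
  moreover have "coeff (monom 1 1 * (monom 1 1 * pderiv p)) k
      = (real k - 1) * coeff (monom 1 1 * p) k"
    unfolding coeff_monom_mult[of _ _ "monom 1 1 * pderiv p"] coeff_X_mult_pderiv
    by (cases k) (simp_all add: coeff_monom_mult)
  ultimately show ?thesis
    by (simp only: coeff_diff coeff_X_mult_pderiv)
qed

lemma coeff_linear_mult: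
  fixes p :: "'a::comm_semiring_1 poly"
  shows "coeff ([:a, b:] * p) k = a * coeff p k + b * coeff (monom 1 1 * p) k"
  by (cases k) (simp_all add: coeff_monom_mult)

lemma coeff_X_minus_1_squared_mult:
  fixes p :: "real poly"
  shows "coeff ([:-1, 1:]\<^sup>2 * p) k
    = coeff p k - 2 * coeff (monom 1 1 * p) k + coeff (monom 1 2 * p) k"
proof -
  have "[:-1, 1:]\<^sup>2 * p = p - smult 2 (monom 1 1 * p) + monom 1 2 * p"
    by (simp add: monom_altdef power2_eq_square algebra_simps)
  then show ?thesis
    by simp
qed

section \<open>The recurrence, coefficient by coefficient\<close>

theorem theorem3p1:
  fixes \<alpha> \<beta> :: real and n :: nat
  assumes "n \<ge> 2" and "T1 \<alpha> \<beta> n \<noteq> 0"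
  shows "F \<alpha> \<beta> (n + 1) =
      [: 2 * (real n - 1) * T5 \<alpha> \<beta> n / ((real n + 1) * T1 \<alpha> \<beta> n),
         2 * T2 \<alpha> \<beta> n / T1 \<alpha> \<beta> n :] * F \<alpha> \<beta> n
    - (if n = 2 then 0
       else smult ((real n - 2) * T3 \<alpha> \<beta> n / ((real n + 1) * T1 \<alpha> \<beta> n))
              ([:-1, 1:]\<^sup>2 * F \<alpha> \<beta> (n - 1)))
    - smult (2 * T4 \<alpha> \<beta> n / (real n * (real n + 1) * T1 \<alpha> \<beta> n))
        ([:0, 1:] * [:-1, 1:] * pderiv (F \<alpha> \<beta> n))"
    (is "?L = ?P - ?Q - ?R")
proof (rule poly_eqI)
  fix k
  obtain p where n: "n = Suc (Suc p)"
    using assms(1) by (metis add_2_eq_Suc le_Suc_ex)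
  \<comment> \<open>The lowest row needed is p = n - 2, three absorptions below row n + 1 = p + 3.
    These divide by x+3, x+2 and x+1, so with this \<open>b\<close> every entry is a polynomial in x
    and y times \<open>b\<close>.\<close>
  define x y b where "x = real p" and "y = real k"
    and "b = real (Suc n choose k) / ((x + 1) * (x + 2) * (x + 3))"
  have x: "x \<ge> 0"
    by (simp add: x_def)
  have real_n: "real n = x + 2"
    by (simp add: n x_def)
  have B: "real (Suc n choose k) = (x + 1) * (x + 2) * (x + 3) * b"
    using x by (simp add: b_def)
  \<comment> \<open>The letters c, d, e stand for rows n, n - 1, n - 2. The plain rules keep the
    shift, the \<open>_shift\<close> rules raise it by one.\<close>
  have c_step: "shifted_choose n k j = v"
    if "(x + 3 + j - y) * shifted_choose (Suc n) k j = (x + 3) * v" for j v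
    using that by (intro shifted_choose_eqI) (simp add: n x_def y_def algebra_simps)
  have c_step_shift: "shifted_choose n k (Suc j) = v"
    if "(y - j) * shifted_choose (Suc n) k j = (x + 3) * v" for j v
    using that by (intro shifted_choose_shift_eqI) (simp add: n x_def y_def algebra_simps)
  have d_step: "shifted_choose (Suc p) k j = v"
    if "(x + 2 + j - y) * shifted_choose n k j = (x + 2) * v" for j v
    using that by (intro shifted_choose_eqI) (simp add: n x_def y_def algebra_simps)
  have d_step_shift: "shifted_choose (Suc p) k (Suc j) = v"
    if "(y - j) * shifted_choose n k j = (x + 2) * v" for j v
    using that by (intro shifted_choose_shift_eqI) (simp add: n x_def y_def algebra_simps)
  have e_step: "shifted_choose p k j = v"
    if "(x + 1 + j - y) * shifted_choose (Suc p) k j = (x + 1) * v" for j v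
    using that by (intro shifted_choose_eqI) (simp add: n x_def y_def algebra_simps)
  have e_step_shift: "shifted_choose p k (Suc j) = v"
    if "(y - j) * shifted_choose (Suc p) k j = (x + 1) * v" for j v
    using that by (intro shifted_choose_shift_eqI) (simp add: n x_def y_def algebra_simps)
  have c: "shifted_choose n k 0 = (x + 1) * (x + 2) * (x + 3 - y) * b"
    "shifted_choose n k 1 = (x + 1) * (x + 2) * y * b"
    using c_step[of 0] c_step_shift[of 0] by (simp_all add: B del: binomial_Suc_Suc)
  have d: "shifted_choose (Suc p) k 0 = (x + 1) * (x + 2 - y) * (x + 3 - y) * b"
    "shifted_choose (Suc p) k 1 = (x + 1) * (x + 3 - y) * y * b"
    "shifted_choose (Suc p) k 2 = (x + 1) * (y - 1) * y * b"
  proof -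
    show "shifted_choose (Suc p) k 0 = (x + 1) * (x + 2 - y) * (x + 3 - y) * b"
      by (rule d_step) (simp only: c, simp add: algebra_simps)
    show "shifted_choose (Suc p) k 1 = (x + 1) * (x + 3 - y) * y * b"
      by (rule d_step) (simp only: c, simp add: algebra_simps)
    have "shifted_choose (Suc p) k (Suc 1) = (x + 1) * (y - 1) * y * b"
      by (rule d_step_shift) (simp only: c, simp add: algebra_simps)
    then show "shifted_choose (Suc p) k 2 = (x + 1) * (y - 1) * y * b"
      by (simp only: Suc_1)
  qed
  have e: "shifted_choose p k 0 = (x + 1 - y) * (x + 2 - y) * (x + 3 - y) * b"
    "shifted_choose p k 1 = (x + 2 - y) * (x + 3 - y) * y * b"
    "shifted_choose p k 2 = (x + 3 - y) * (y - 1) * y * b"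
    "shifted_choose p k 3 = (y - 2) * (y - 1) * y * b"
  proof -
    show "shifted_choose p k 0 = (x + 1 - y) * (x + 2 - y) * (x + 3 - y) * b"
      by (rule e_step) (simp only: d, simp add: algebra_simps)
    show "shifted_choose p k 1 = (x + 2 - y) * (x + 3 - y) * y * b"
      by (rule e_step) (simp only: d, simp add: algebra_simps)
    show "shifted_choose p k 2 = (x + 3 - y) * (y - 1) * y * b"
      by (rule e_step) (simp only: d, simp add: algebra_simps)
    have "shifted_choose p k (Suc 2) = (y - 2) * (y - 1) * y * b"
      by (rule e_step_shift) (simp only: d, simp add: algebra_simps)
    then show "shifted_choose p k 3 = (y - 2) * (y - 1) * y * b"
      by simp
  qed

  \<comment> \<open>Here f1 belongs to F_(n+1), the other f to F_n and the g to F_(n-1); the last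
    digit is the power of x multiplied in.\<close>
  define f1 f00 f01 g0 g1 g2
    where "f1 = coeff (monom 1 0 * F \<alpha> \<beta> (Suc n)) k"
      and "f00 = coeff (monom 1 0 * F \<alpha> \<beta> n) k"
      and "f01 = coeff (monom 1 1 * F \<alpha> \<beta> n) k"
      and "g0 = coeff (monom 1 0 * F \<alpha> \<beta> (Suc p)) k"
      and "g1 = coeff (monom 1 1 * F \<alpha> \<beta> (Suc p)) k"
      and "g2 = coeff (monom 1 2 * F \<alpha> \<beta> (Suc p)) k"
  have coeffs: "coeff (F \<alpha> \<beta> (Suc n)) k = f1" "coeff (F \<alpha> \<beta> n) k = f00"
    "coeff (F \<alpha> \<beta> (Suc p)) k = g0"
    by (simp_all add: f1_def f00_def g0_def monom_0)
  have Suc_p: "real (Suc p) = x + 1"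
    by (simp add: x_def)
  have Suc_2: "Suc 2 = 3"
    by simp
  \<comment> \<open>\<open>coeff_monom_mult_F\<close> carries the factor x + 2 here and x + 1 for
    \<open>f00\<close> and \<open>f01\<close>; both are positive and cancel.\<close>
  have f1: "f1 = (x + 1)\<^sup>2 * (x + 2) * (x + 3)
      * (\<alpha> * (x + 2) * (x + 3) + \<beta> * y * (x + 3 - y)) * b\<^sup>2"
  proof -
    have "(x + 2) * f1 = (x + 2) * ((x + 1)\<^sup>2 * (x + 2) * (x + 3)
      * (\<alpha> * (x + 2) * (x + 3) + \<beta> * y * (x + 3 - y)) * b\<^sup>2)"
      using coeff_monom_mult_F[of n 0 \<alpha> \<beta> k]
      unfolding f1_def[symmetric] One_nat_def[symmetric] c shifted_choose_0[of "Suc n"] B real_n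
      by algebra
    then show ?thesis
      using x by simp
  qed
  have f00: "f00 = (x + 1) * (x + 2) * (x + 3 - y)\<^sup>2
      * (\<alpha> * (x + 1) * (x + 2) + \<beta> * y * (x + 2 - y)) * b\<^sup>2"
  proof -
    have "(x + 1) * f00 = (x + 1) * ((x + 1) * (x + 2) * (x + 3 - y)\<^sup>2
      * (\<alpha> * (x + 1) * (x + 2) + \<beta> * y * (x + 2 - y)) * b\<^sup>2)"
      using coeff_monom_mult_F[of "Suc p" 0 \<alpha> \<beta> k]
      unfolding n[symmetric] f00_def[symmetric] One_nat_def[symmetric] c d Suc_p
      by algebra
    then show ?thesis
      using x by simp
  qed
  have f01: "f01 = (x + 1) * (x + 2) * y\<^sup>2
      * (\<alpha> * (x + 1) * (x + 2) + \<beta> * (x + 3 - y) * (y - 1)) * b\<^sup>2"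
  proof -
    have "(x + 1) * f01 = (x + 1) * ((x + 1) * (x + 2) * y\<^sup>2
      * (\<alpha> * (x + 1) * (x + 2) + \<beta> * (x + 3 - y) * (y - 1)) * b\<^sup>2)"
      using coeff_monom_mult_F[of "Suc p" 1 \<alpha> \<beta> k]
      unfolding n[symmetric] f01_def[symmetric] Suc_1 c d Suc_p
      by algebra
    then show ?thesis
      using x by simp
  qed
  \<comment> \<open>Now the factor is x = n - 2, which may be 0, so it stays. This suffices, since
    the F_(n-1) term of the recurrence has the same factor.\<close>
  have g0: "x * g0 = (x + 1) * (x + 2 - y)\<^sup>2 * (x + 3 - y)\<^sup>2
      * (\<alpha> * x * (x + 1) + \<beta> * y * (x + 1 - y)) * b\<^sup>2"
    using coeff_monom_mult_F[of p 0 \<alpha> \<beta> k]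
    unfolding g0_def[symmetric] One_nat_def[symmetric] d e x_def[symmetric]
    by algebra
  have g1: "x * g1 = (x + 1) * (x + 3 - y)\<^sup>2 * y\<^sup>2
      * (\<alpha> * x * (x + 1) + \<beta> * (x + 2 - y) * (y - 1)) * b\<^sup>2"
    using coeff_monom_mult_F[of p 1 \<alpha> \<beta> k]
    unfolding g1_def[symmetric] Suc_1 d e x_def[symmetric]
    by algebra
  have g2: "x * g2 = (x + 1) * (y - 1)\<^sup>2 * y\<^sup>2
      * (\<alpha> * x * (x + 1) + \<beta> * (x + 3 - y) * (y - 2)) * b\<^sup>2"
    using coeff_monom_mult_F[of p 2 \<alpha> \<beta> k]
    unfolding g2_def[symmetric] Suc_2 d e x_def[symmetric]
    by algebra

  define t1 t2 t3 t4 t5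
    where "t1 = T1 \<alpha> \<beta> n" and "t2 = T2 \<alpha> \<beta> n" and "t3 = T3 \<alpha> \<beta> n"
      and "t4 = T4 \<alpha> \<beta> n" and "t5 = T5 \<alpha> \<beta> n"
  \<comment> \<open>The recurrence times n(n+1)T1, with x distributed so that g0, g1, g2 occur only
    in the known products. What remains is a polynomial identity in x, y, \<alpha>, \<beta>,
    b.\<close>
  have cleared: "(x + 2) * (x + 3) * t1 * f1
      = 2 * (x + 2) * (x + 3) * t2 * f01 + 2 * (x + 1) * (x + 2) * t5 * f00
        - (x + 2) * t3 * (x * g0 - 2 * (x * g1) + x * g2)
        - 2 * t4 * ((y - 1) * f01 - y * f00)"
    unfolding f1 f00 f01 g0 g1 g2 t1_def t2_def t3_def t4_def t5_def
      T1_def T2_def T3_def T4_def T5_def real_n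
    by algebra
  have "coeff ?P k = 2 * (x + 1) * t5 / ((x + 3) * t1) * f00 + 2 * t2 / t1 * f01"
    unfolding coeff_linear_mult coeffs f01_def[symmetric]
    by (simp add: real_n t1_def t2_def t5_def add.commute)
  \<comment> \<open>For n = 2 the right-hand side is 0 too, because x = 0.\<close>
  moreover have "coeff ?Q k = x * t3 / ((x + 3) * t1) * (g0 - 2 * g1 + g2)"
  proof (cases "n = 2")
    case True
    then show ?thesis
      using real_n by simp
  next
    case False
    have pred_n: "n - 1 = Suc p"
      by (simp add: n)
    show ?thesis
      unfolding if_not_P[OF False] pred_n coeff_smult coeff_X_minus_1_squared_mult coeffs
        g1_def[symmetric] g2_def[symmetric]
      by (simp add: real_n t1_def t3_def add.commute)
  qed
  moreover have "coeff ?R k = 2 * t4 / ((x + 2) * (x + 3) * t1) * ((y - 1) * f01 - y * f00)"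
    unfolding coeff_smult coeff_X_mult_X_minus_1_mult_pderiv coeffs f01_def[symmetric]
    by (simp add: real_n t1_def t4_def y_def add.commute)
  \<comment> \<open>Dividing \<open>cleared\<close> by n(n+1)T1 is where T1 \<noteq> 0
    enters.\<close>
  moreover have "f1 = 2 * (x + 1) * t5 / ((x + 3) * t1) * f00 + 2 * t2 / t1 * f01
      - x * t3 / ((x + 3) * t1) * (g0 - 2 * g1 + g2)
      - 2 * t4 / ((x + 2) * (x + 3) * t1) * ((y - 1) * f01 - y * f00)"
  proof -
    have nz: "t1 \<noteq> 0" "x + 2 \<noteq> 0" "x + 3 \<noteq> 0"
      using assms(2) x by (simp_all add: t1_def)
    then have "f1 = (x + 2) * (x + 3) * t1 * f1 / ((x + 2) * (x + 3) * t1)"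
      by simp
    then show ?thesis
      unfolding cleared using nz by (simp add: divide_simps) (simp add: algebra_simps)
  qed
  ultimately show "coeff ?L k = coeff (?P - ?Q - ?R) k"
    by (simp only: coeff_diff coeffs Suc_eq_plus1[symmetric])
qed

end
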